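(* Let $n\ge 1$, let $A=(a_{ij})\in M_n(\mathbf{C})$, and let $F=X+(AX)^{*3}:\mathbf{C}^n\to\mathbf{C}^n$ be the associated Druzkowski mapping. If $\operatorname{Tr} J\big((AX)^{*3}\big)=0$ (as a polynomial in $x_1,\dots,x_n$), then $$\operatorname{rank}(A)\le \tfrac12 (n+\delta),$$ where $\delta$ is the number of diagonal elements $a_{ii}$ ($1\le i\le n$) of $A$ which are equal to zero.
   Context: $X=(x_1,\dots,x_n)^t$ is the column vector of variables. For a matrix $A=(a_{ij})_{n\times n}$ with complex entries, $(AX)^{*3}$ denotes the column vector whose $i$-th component is $(a_{i1}x_1+\cdots+a_{in}x_n)^3$. A Druzkowski (cubic linear) mapping is a polynomial mapping $F:\mathbf{C}^n\to\mathbf{C}^n$ of the form $F=X+(AX)^{*3}$, i.e. $F_i=x_i+(a_{i1}x_1+\cdots+a_{in}x_n)^3$ for $1\le i\le n$. For a polynomial mapping $G=(G_1,\dots,G_n)^t$, $JG=(\partial G_i/\partial x_j)_{n\times n}$ is its Jacobian matrix, and $\operatorname{Tr}$ denotes the trace. *)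

theory Defs
  imports "HOL-Analysis.Analysis"
begin

definition cubic_part :: "complex^'n^'n \<Rightarrow> complex^'n \<Rightarrow> complex^'n" where
  "cubic_part A x = (\<chi> i. ((A *v x) $ i) ^ 3)"

definition druzkowski_map :: "complex^'n^'n \<Rightarrow> complex^'n \<Rightarrow> complex^'n" where
  "druzkowski_map A x = x + cubic_part A x"

text \<open>
  Polynomial mappings are represented by the functions they induce on complex n-space.
  The complex partial derivative in the j-th variable is the library's \<open>deriv\<close> applied to
  the function of one complex variable obtained by freezing all other coordinates.
  The library's \<open>jacobian\<close> is not used since it is built on the real Frechet derivative.
\<close>

definition partial_deriv :: "'n \<Rightarrow> (complex^'n \<Rightarrow> complex) \<Rightarrow> complex^'n \<Rightarrow> complex" where
  "partial_deriv j g x = deriv (\<lambda>t. g (\<chi> k. if k = j then t else x $ k)) (x $ j)"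

definition jacobian_matrix :: "(complex^'n \<Rightarrow> complex^'n) \<Rightarrow> complex^'n \<Rightarrow> complex^'n^'n" where
  "jacobian_matrix G x = (\<chi> i j. partial_deriv j (\<lambda>y. G y $ i) x)"

end

theory Submission
  imports Defs
begin

text \<open>
  The trace of the Jacobian is \<open>3 \<Sum>\<^sub>i a\<^sub>i\<^sub>i (A x)\<^sub>i\<^sup>2\<close>, so its vanishing says that the column
  space \<open>V\<close> of \<open>A\<close> is totally isotropic for the diagonal form \<open>D = diag(a\<^sub>i\<^sub>i)\<close>. By polarization
  \<open>D V\<close> lies in the kernel of the transpose of \<open>A\<close>, which has dimension \<open>n - rank A\<close>. Applying
  \<open>D\<close> lowers the dimension of \<open>V\<close> by at most \<open>dim (ker D) = \<delta>\<close>, hence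
  \<open>rank A - \<delta> \<le> n - rank A\<close>.
\<close>

text \<open>Rank factorization: expanding the columns in a basis \<open>B\<close> of their span
  writes \<open>A\<close> as a product with inner dimension \<open>card B\<close>. Read along rows,
  the same product expands every row in the coefficient vectors \<open>w b\<close>.\<close>

lemma dim_rows_le_dim_columns_gen:
  fixes A :: "'a::field^'n^'m"
  shows "vec.dim (rows A) \<le> vec.dim (columns A)"
proof -
  obtain B where B: "vec.independent B" "columns A \<subseteq> vec.span B" "card B = vec.dim (columns A)"
    using vec.basis_exists by metis
  have fin: "finite B"
    using B(1) by (rule vec.finiteI_independent)
  have "\<forall>j. \<exists>u. column j A = (\<Sum>b\<in>B. u b *s b)"
    using B(2) by (auto simp: vec.span_finite[OF fin] columns_def)
  then obtain u where u: "\<And>j. column j A = (\<Sum>b\<in>B. u j b *s b)"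
    by metis
  define w where "w b = (\<chi> j. u j b)" for b
  have "row i A = (\<Sum>b\<in>B. (b $ i) *s w b)" for i
  proof -
    have "A $ i $ j = (\<Sum>b\<in>B. u j b * b $ i)" for j
      using arg_cong[OF u[of j], of "\<lambda>v. v $ i"] by (simp add: column_def sum_component)
    then show ?thesis
      by (simp add: vec_eq_iff row_def w_def mult.commute)
  qed
  then have "rows A \<subseteq> vec.span (w ` B)"
    by (auto simp: rows_def intro!: vec.span_sum vec.span_scale intro: vec.span_base)
  then have "vec.dim (rows A) \<le> card (w ` B)"
    using fin by (intro vec.dim_le_card) auto
  also have "\<dots> \<le> card B"
    using fin by (rule card_image_le)
  finally show ?thesis
    using B(3) by simp
qed

lemma matrix_vector_mult_axis_gen:
  fixes A :: "'a::field^'n^'m"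
  shows "A *v axis j 1 = column j A"
  by (simp add: vec_eq_iff column_def matrix_vector_mult_def axis_def if_distrib cong: if_cong)

lemma dim_columns_le_dim_range:
  fixes A :: "'a::field^'n^'m"
  shows "vec.dim (columns A) \<le> vec.dim (range ((*v) A))"
  by (rule vec.dim_subset) (auto simp: columns_def simp flip: matrix_vector_mult_axis_gen)

text \<open>Half of rank-nullity: a basis \<open>C\<close> of \<open>S\<close> extends to a basis
  \<open>B\<close> of the whole space, and since \<open>M\<close> kills \<open>C\<close>, the images
  of \<open>B - C\<close> already span the range.\<close>

lemma dim_range_plus_dim_kernel_le:
  fixes M :: "'a::field^'n^'m"
  assumes S: "\<And>x. x \<in> S \<Longrightarrow> M *v x = 0"
  shows "vec.dim (range ((*v) M)) + vec.dim S \<le> CARD('n)"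
proof -
  obtain C where C: "C \<subseteq> S" "vec.independent C" "card C = vec.dim S"
    using vec.basis_exists by metis
  obtain B where B: "C \<subseteq> B" "vec.independent B" "UNIV \<subseteq> vec.span B"
    using vec.maximal_independent_subset_extend[of C UNIV] C(2) by auto
  have fin: "finite B"
    using B(2) by (rule vec.finiteI_independent)
  have card_B: "card B = CARD('n)"
    using B(2,3) vec.dim_eq_card[of B UNIV] vec_dim_card by (metis top.extremum_uniqueI vec.span_UNIV)
  have "M *v b \<in> vec.span ((*v) M ` (B - C))" if "b \<in> B" for b
  proof (cases "b \<in> C")
    case True
    then show ?thesis
      using S[of b] C(1) by (auto simp: vec.span_zero)
  next
    case False
    then show ?thesis
      using that by (intro vec.span_base) auto
  qed
  then have "vec.span ((*v) M ` B) \<subseteq> vec.span ((*v) M ` (B - C))"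
    by (intro vec.span_minimal vec.subspace_span) auto
  moreover have "range ((*v) M) = vec.span ((*v) M ` B)"
    using B(3) by (simp add: vec.span_image top.extremum_unique)
  ultimately have "vec.dim (range ((*v) M)) \<le> card ((*v) M ` (B - C))"
    using fin by (intro vec.dim_le_card) auto
  also have "\<dots> \<le> card (B - C)"
    using fin by (intro card_image_le) auto
  also have "\<dots> = CARD('n) - vec.dim S"
    using B(1) fin C(3) card_B by (metis card_Diff_subset finite_subset)
  finally show ?thesis
    using B(1) C(3) card_B card_mono[OF fin, of C] by linarith
qed

text \<open>A vector is recovered from its diagonal image except in the coordinates where
  \<open>d\<close> vanishes. So \<open>V\<close> is spanned by a pulled-back basis of the image
  together with one unit vector per zero of \<open>d\<close>.\<close>

lemma dim_le_dim_diagonal_image: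
  fixes d :: "'n::finite \<Rightarrow> 'a::field"
  shows "vec.dim V \<le> vec.dim ((\<lambda>v. \<chi> i. d i * v $ i) ` V) + card {i. d i = 0}"
    (is "_ \<le> vec.dim (?D ` V) + card ?Z")
proof -
  obtain B where B: "vec.independent B" "?D ` V \<subseteq> vec.span B" "card B = vec.dim (?D ` V)"
    by (rule vec.basis_exists)
  have fin: "finite B"
    using B(1) by (rule vec.finiteI_independent)
  define E :: "'a^'n^'n" where "E = (\<chi> i j. if i = j then inverse (d i) else 0)"
  define G where "G = (*v) E ` B \<union> (\<lambda>i. axis i 1) ` ?Z"
  have E: "(E *v x) $ i = inverse (d i) * x $ i" for x i
    by (simp add: E_def matrix_vector_mult_def if_distrib[of "\<lambda>c. c * _"] cong: if_cong)
  have "v \<in> vec.span G" if "v \<in> V" for v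
  proof -
    \<comment> \<open>\<open>E\<close> inverts \<open>D\<close> off the zero set of \<open>d\<close>, on which \<open>inverse 0 = 0\<close>.\<close>
    have split: "v = E *v ?D v + (\<Sum>i\<in>?Z. v $ i *s axis i 1)"
      by (simp add: vec_eq_iff E sum_component axis_def if_distrib sum.If_cases
          cong: if_cong)
    have "E *v ?D v \<in> vec.span ((*v) E ` B)"
      using B(2) that by (auto simp: vec.span_image)
    then have E_mem: "E *v ?D v \<in> vec.span G"
      using vec.span_mono[of "(*v) E ` B" G] by (auto simp: G_def)
    have Z_mem: "(\<Sum>i\<in>?Z. v $ i *s axis i 1) \<in> vec.span G"
      by (auto simp: G_def intro!: vec.span_sum vec.span_scale intro: vec.span_base)
    show ?thesis
      by (subst split) (rule vec.span_add[OF E_mem Z_mem])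
  qed
  then have "vec.dim V \<le> card G"
    using fin by (intro vec.dim_le_card) (auto simp: G_def)
  also have "\<dots> \<le> card ((*v) E ` B) + card ((\<lambda>i. axis i 1 :: 'a^'n) ` ?Z)"
    unfolding G_def by (rule card_Un_le)
  also have "\<dots> \<le> card B + card ?Z"
    using fin by (intro add_mono card_image_le) auto
  finally show ?thesis
    using B(3) by simp
qed

lemma partial_deriv_cubic_part:
  "partial_deriv j (\<lambda>y. cubic_part A y $ i) x = 3 * A $ i $ j * ((A *v x) $ i)\<^sup>2"
proof -
  have "(A *v (\<chi> k. if k = j then t else x $ k)) $ i = (A *v x) $ i + A $ i $ j * (t - x $ j)" for t
  proof -
    \<comment> \<open>Replacing one coordinate is a translation along an axis, so the linear form
      becomes affine in \<open>t\<close> with slope \<open>A $ i $ j\<close>.\<close>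
    have "(\<chi> k. if k = j then t else x $ k) = x + (t - x $ j) *s axis j 1"
      by (simp add: vec_eq_iff axis_def)
    then show ?thesis
      by (simp only: matrix_vector_right_distrib vector_scalar_commute matrix_vector_mult_axis_gen)
        (simp add: column_def algebra_simps)
  qed
  then have "partial_deriv j (\<lambda>y. cubic_part A y $ i) x
      = deriv (\<lambda>t. ((A *v x) $ i + A $ i $ j * (t - x $ j)) ^ 3) (x $ j)"
    by (simp add: partial_deriv_def cubic_part_def)
  also have "\<dots> = 3 * A $ i $ j * ((A *v x) $ i)\<^sup>2"
    by (rule DERIV_imp_deriv) (auto intro!: derivative_eq_intros)
  finally show ?thesis .
qed

lemma trace_jacobian_cubic_part:
  "trace (jacobian_matrix (cubic_part A) x) = 3 * (\<Sum>i\<in>UNIV. A $ i $ i * ((A *v x) $ i)\<^sup>2)"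
  by (simp add: trace_def jacobian_matrix_def partial_deriv_cubic_part sum_distrib_left mult.assoc)

text \<open>A quadratic form \<open>q\<close> determines its bilinear form through
  \<open>q (x + y) - q x - q y\<close>, which is twice that form; characteristic zero allows
  cancelling the 2.\<close>

lemma diagonal_form_polarization:
  fixes d :: "'n::finite \<Rightarrow> 'a::field_char_0"
  assumes iso: "\<And>x. (\<Sum>i\<in>UNIV. d i * ((A *v x) $ i)\<^sup>2) = 0"
  shows "(\<Sum>i\<in>UNIV. (A *v y) $ i * (d i * (A *v x) $ i)) = 0"
proof -
  have "2 * (\<Sum>i\<in>UNIV. (A *v y) $ i * (d i * (A *v x) $ i))
      = (\<Sum>i\<in>UNIV. d i * ((A *v (x + y)) $ i)\<^sup>2)
        - (\<Sum>i\<in>UNIV. d i * ((A *v x) $ i)\<^sup>2) - (\<Sum>i\<in>UNIV. d i * ((A *v y) $ i)\<^sup>2)"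
    by (simp add: matrix_vector_right_distrib sum_distrib_left power2_eq_square algebra_simps
        flip: sum_subtractf sum.distrib)
  then show ?thesis
    by (simp only: iso) simp
qed

theorem mainTheorem1:
  fixes A :: "complex^'n^'n"
    and F :: "complex^'n \<Rightarrow> complex^'n"
    and \<delta> :: nat
  assumes "F = druzkowski_map A"
    and "\<forall>x. trace (jacobian_matrix (cubic_part A) x) = 0"
    and "\<delta> = card {i. A $ i $ i = 0}"
  shows "real (rank A) \<le> (real CARD('n) + real \<delta>) / 2"
proof -
  let ?V = "range ((*v) A)"
  let ?DV = "(\<lambda>v. \<chi> i. A $ i $ i * v $ i) ` ?V"
  have iso: "(\<Sum>i\<in>UNIV. A $ i $ i * ((A *v x) $ i)\<^sup>2) = 0" for x
    using assms(2) by (simp add: trace_jacobian_cubic_part)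
  have ker: "transpose A *v z = 0" if "z \<in> ?DV" for z
  proof -
    obtain x where z: "z = (\<chi> i. A $ i $ i * (A *v x) $ i)"
      using \<open>z \<in> ?DV\<close> by blast
    \<comment> \<open>Each entry pairs \<open>z\<close> with a column of \<open>A\<close>, that is,
      with the vector \<open>A *v axis j 1\<close> of \<open>?V\<close>, so polarization
      applies.\<close>
    have "(transpose A *v z) $ j = (\<Sum>i\<in>UNIV. (A *v axis j 1) $ i * (A $ i $ i * (A *v x) $ i))"
      for j
      by (simp add: z matrix_vector_mult_axis_gen column_def transpose_def
          matrix_vector_mult_def[of "\<chi> i j. A $ j $ i"])
    then show ?thesis
      by (simp add: vec_eq_iff diagonal_form_polarization[OF iso])
  qed
  \<comment> \<open>\<open>rank\<close> is the dimension of the row span, and the rows of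
    \<open>A\<close> are the columns of its transpose.\<close>
  have "rank A \<le> vec.dim (range ((*v) (transpose A)))"
    using dim_columns_le_dim_range[of "transpose A"] by (simp add: row_rank_def_gen)
  moreover have "vec.dim (range ((*v) (transpose A))) + vec.dim ?DV \<le> CARD('n)"
    by (rule dim_range_plus_dim_kernel_le) (rule ker)
  \<comment> \<open>Here rows must be compared with columns of the same matrix, which is where the
    rank factorization enters.\<close>
  moreover have "rank A \<le> vec.dim ?V"
    using dim_rows_le_dim_columns_gen[of A] dim_columns_le_dim_range[of A]
    by (simp add: row_rank_def_gen)
  moreover have "vec.dim ?V \<le> vec.dim ?DV + \<delta>"
    unfolding assms(3) by (rule dim_le_dim_diagonal_image)
  ultimately have "2 * rank A \<le> CARD('n) + \<delta>"
    by linarith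
  then have "real (2 * rank A) \<le> real (CARD('n) + \<delta>)"
    by (rule of_nat_mono)
  then show ?thesis
    by simp
qed

end
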